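(* Let $0<\varepsilon<e^{-1}$ and suppose there are constants $\alpha,\alpha',\beta,\beta',\gamma>0$ with $\alpha\ge \tfrac12\min(\beta,\gamma)$ and constants $C_{M1},C_{M2},C_{M3},C_{M4}>0$ (independent of $\ell$, of the $N_\ell$ and of $\varepsilon$) such that, for all levels $\ell$ and all $N_\ell\in\mathbb N$: (M1) $\left|\mathbb E_{\nu^\ell}[Q_\ell]-\mathbb E_\rho[Q]\right|\le C_{M1}\left(M_\ell^{-\alpha}+R_\ell^{-\alpha'}\right)$; (M2) $\mathbb V_{\nu^{\ell,\ell-1}}[Y_\ell]\le C_{M2}\left(M_{\ell-1}^{-\beta}+R_{\ell-1}^{-\beta'}\right)$; (M3) $\mathbb V_{\boldsymbol\Theta_\ell}[\widehat Y^{\mathrm{MC}}_{\ell,N_\ell}]+\left(\mathbb E_{\boldsymbol\Theta_\ell}[\widehat Y^{\mathrm{MC}}_{\ell,N_\ell}]-\mathbb E_{\nu^{\ell,\ell-1}}[\widehat Y^{\mathrm{MC}}_{\ell,N_\ell}]\right)^2\le C_{M3}\,N_\ell^{-1}\,\mathbb V_{\nu^{\ell,\ell-1}}[Y_\ell]$; (M4) $\mathcal C_\ell\le C_{M4}\,M_\ell^{\gamma}$. Suppose also that $R_\ell\gtrsim M_\ell^{\max\{\alpha/\alpha',\,\beta/\beta'\}}$ with a constant independent of $\ell$. Then there exist a number of levels $L$ and a sequence $\{N_\ell\}_{\ell=0}^L$ such that $$e(\widehat Q^{\mathrm{ML}}_{L,\{N_\ell\}})^2:=\mathbb E_{\cup_\ell\boldsymbol\Theta_\ell}\left[\left(\widehat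 Q^{\mathrm{ML}}_{L,\{N_\ell\}}-\mathbb E_\rho[Q]\right)^2\right]<\varepsilon^2$$ and $$\mathcal C_\varepsilon(\widehat Q^{\mathrm{ML}}_{L,\{N_\ell\}})\le C_{ML}\begin{cases}\varepsilon^{-2}|\log\varepsilon|,&\text{if }\beta>\gamma,\\ \varepsilon^{-2}|\log\varepsilon|^3,&\text{if }\beta=\gamma,\\ \varepsilon^{-2-(\gamma-\beta)/\alpha}|\log\varepsilon|,&\text{if }\beta<\gamma,\end{cases}$$ with a constant $C_{ML}$ independent of $\varepsilon$.
   Context: Levels: $M_0<M_1<\dots$ are positive integers with $M_\ell=s\,M_{\ell-1}$ for a fixed integer $s\ge2$, and $R_0\le R_1\le\dots$ are positive integers. For each $\ell\ge 0$, $\nu^\ell$ is a probability measure on $\mathbb R^{R_\ell}$ (the level-$\ell$ posterior) and $Q_\ell=Q_\ell(\theta_\ell)$ is a real-valued function of $\theta_\ell\in\mathbb R^{R_\ell}$. $\mathbb E_\rho[Q]\in\mathbb R$ is the exact target expectation of a limit quantity $Q$ under a limit measure $\rho$. Chains: for $\ell\ge1$, $\boldsymbol\Theta_\ell=\{\theta_\ell^n\}_{n}\cup\{\Theta_{\ell-1}^n\}_{n}$ is a pair of (correlated) stochastic processes, generated by a two-level Metropolis–Hastings algorithm, with $\theta_\ell^n\in\mathbb R^{R_\ell}$ and $\Theta_{\ell-1}^n\in\mathbb R^{R_{\ell-1}}$; $\boldsymbol\Theta_0=\{\theta_0^n\}_n$ is generated by a standard Metropolis–Hastings algorithm with target $\nu^0$.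 $\mathbb E_{\boldsymbol\Theta_\ell},\mathbb V_{\boldsymbol\Theta_\ell}$ are expectation and variance with respect to the actual law of $\boldsymbol\Theta_\ell$, and $\mathbb E_{\cup_\ell\boldsymbol\Theta_\ell}$ is expectation under the joint law of all these processes; the processes for different $\ell$ need not be independent. $\nu^{\ell,\ell-1}$ denotes the joint (stationary) distribution of $(\theta_\ell,\Theta_{\ell-1})$, whose marginals are $\nu^\ell$ and $\nu^{\ell-1}$ and whose correlation is determined by the algorithm. Estimators: for $\ell\ge1$, $Y_\ell:=Q_\ell(\theta_\ell)-Q_{\ell-1}(\Theta_{\ell-1})$ and $Y_\ell^n:=Q_\ell(\theta^n_\ell)-Q_{\ell-1}(\Theta^n_{\ell-1})$; $Y_0:=Q_0$, $Y_0^n:=Q_0(\theta_0^n)$, with the conventions $\nu^{0,-1}:=\nu^0$, $M_{-1}=R_{-1}=1$. For burn-in lengths $n_0^\ell\ge0$ set $$\widehat Y^{\mathrm{MC}}_{\ell,N_\ell}:=\frac1{N_\ell}\sum_{n=n_0^\ell+1}^{n_0^\ell+N_\ell}Y_\ell^n,\qquad \widehat Q^{\mathrm{ML}}_{L,\{N_\ell\}}:=\sum_{\ell=0}^L\widehat Y^{\mathrm{MC}}_{\ell,N_\ell}.$$ Thus $\mathbb E_{\nu^{\ell,\ell-1}}[\widehat Y^{\mathrm{MC}}_{\ell,N_\ell}]=\mathbb E_{\nu^\ell}[Q_\ell]-\mathbb E_{\nu^{\ell-1}}[Q_{\ell-1}]$ for $\ell\ge1$, and it equals $\mathbb E_{\nu^0}[Q_0]$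 for $\ell=0$. Cost: $\mathcal C_\ell$ is the cost of advancing the level-$\ell$ algorithm by one state $n\to n+1$, and the cost of the multilevel estimator is $\sum_{\ell=0}^L N_\ell\,\mathcal C_\ell$; $\mathcal C_\varepsilon(\cdot)$ denotes this cost for the choice of $L,\{N_\ell\}$ achieving mean square error less than $\varepsilon^2$. $a\gtrsim b$ means $a\ge c\,b$ with a constant $c>0$ independent of $\ell$. *)

theory Defs
  imports "HOL-Probability.Probability"
begin

text \<open>
  The dimension of the parameter space varies with the level, so a point of
  \<open>\<real>\<^sup>d\<close> is a function on the index set \<open>{..<d}\<close> (extensional outside it), and the
  Borel structure is the product one.
\<close>

definition euclid :: "nat \<Rightarrow> (nat \<Rightarrow> real) measure" where
  "euclid d = PiM {..<d} (\<lambda>_. borel)"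

text \<open>
  \<open>prev a l\<close> is \<open>a\<close> at level \<open>l - 1\<close>, with the convention that the value at level \<open>-1\<close> is \<open>1\<close>.
\<close>

definition prev :: "(nat \<Rightarrow> nat) \<Rightarrow> nat \<Rightarrow> real" where
  "prev a l = (if l = 0 then 1 else real (a (l - 1)))"

text \<open>
  \<open>diffY Q l (x, y)\<close> is \<open>Y\<^sub>l\<close> at fine state \<open>x\<close> and coarse state \<open>y\<close>; at level \<open>0\<close> there is
  no coarse state and the second component is ignored.
\<close>

definition diffY ::
  "(nat \<Rightarrow> (nat \<Rightarrow> real) \<Rightarrow> real) \<Rightarrow> nat \<Rightarrow> (nat \<Rightarrow> real) \<times> (nat \<Rightarrow> real) \<Rightarrow> real" where
  "diffY Q l = (\<lambda>(x, y). if l = 0 then Q 0 x else Q l x - Q (l - 1) y)"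

text \<open>
  Mean and variance of \<open>Y\<^sub>l\<close> under the stationary distribution: \<open>nu l\<close> is the level-\<open>l\<close>
  posterior and, for \<open>l \<ge> 1\<close>, \<open>nuJ l\<close> is the joint distribution of the fine and the coarse
  state. The value \<open>nuJ 0\<close> is irrelevant: at level \<open>0\<close> the joint distribution is by
  convention \<open>nu 0\<close>, and \<open>Y\<^sub>0 = Q\<^sub>0\<close>.
\<close>

definition stat_mean where
  "stat_mean nu nuJ Q l =
     (if l = 0 then prob_space.expectation (nu 0) (Q 0)
      else prob_space.expectation (nuJ l) (diffY Q l))"

definition stat_var where
  "stat_var nu nuJ Q l =
     (if l = 0 then prob_space.variance (nu 0) (Q 0)
      else prob_space.variance (nuJ l) (diffY Q l))"

text \<open>
  In the chains below, \<open>th l n\<close> is the fine state and \<open>Th l n\<close> (relevant for \<open>l \<ge> 1\<close>) the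
  coarse state, in dimension \<open>R (l - 1)\<close>, of step \<open>n\<close> of the level-\<open>l\<close> algorithm; \<open>n0\<close>
  gives the burn-in lengths.
\<close>

definition Yhat ::
  "(nat \<Rightarrow> (nat \<Rightarrow> real) \<Rightarrow> real) \<Rightarrow> (nat \<Rightarrow> nat \<Rightarrow> 'w \<Rightarrow> nat \<Rightarrow> real) \<Rightarrow>
   (nat \<Rightarrow> nat \<Rightarrow> 'w \<Rightarrow> nat \<Rightarrow> real) \<Rightarrow> (nat \<Rightarrow> nat) \<Rightarrow> nat \<Rightarrow> nat \<Rightarrow> 'w \<Rightarrow> real" where
  "Yhat Q th Th n0 l N w =
     (1 / real N) * (\<Sum>n = n0 l + 1..n0 l + N. diffY Q l (th l n w, Th l n w))"

text \<open>
  The expectation of \<open>Yhat\<close> when every state of the chain has the stationary distribution;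
  by linearity it only depends on the one-time marginals.
\<close>

definition stat_mean_Yhat where
  "stat_mean_Yhat nu nuJ Q n0 l N =
     (1 / real N) * (\<Sum>n = n0 l + 1..n0 l + N. stat_mean nu nuJ Q l)"

definition QML ::
  "(nat \<Rightarrow> (nat \<Rightarrow> real) \<Rightarrow> real) \<Rightarrow> (nat \<Rightarrow> nat \<Rightarrow> 'w \<Rightarrow> nat \<Rightarrow> real) \<Rightarrow>
   (nat \<Rightarrow> nat \<Rightarrow> 'w \<Rightarrow> nat \<Rightarrow> real) \<Rightarrow> (nat \<Rightarrow> nat) \<Rightarrow> nat \<Rightarrow> (nat \<Rightarrow> nat) \<Rightarrow> 'w \<Rightarrow> real" where
  "QML Q th Th n0 L N w = (\<Sum>l\<le>L. Yhat Q th Th n0 l (N l) w)"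

definition ml_cost :: "(nat \<Rightarrow> real) \<Rightarrow> nat \<Rightarrow> (nat \<Rightarrow> nat) \<Rightarrow> real" where
  "ml_cost Cst L N = (\<Sum>l\<le>L. real (N l) * Cst l)"

definition ml_rate :: "real \<Rightarrow> real \<Rightarrow> real \<Rightarrow> real \<Rightarrow> real" where
  "ml_rate \<alpha> \<beta> \<gamma> \<epsilon> =
     (if \<beta> > \<gamma> then \<epsilon> powr (-2) * \<bar>ln \<epsilon>\<bar>
      else if \<beta> = \<gamma> then \<epsilon> powr (-2) * \<bar>ln \<epsilon>\<bar> ^ 3
      else \<epsilon> powr (-2 - (\<gamma> - \<beta>) / \<alpha>) * \<bar>ln \<epsilon>\<bar>)"

end

theory Submission
  imports Defs
begin

text \<open>
  Write \<open>e\<^sub>l\<close> for the deviation of the level-\<open>l\<close> estimator from its stationary mean. These means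
  telescope, so the total error is \<open>\<Sum>\<^sub>l e\<^sub>l\<close> plus the deterministic bias of level \<open>L\<close>. Without
  independence, \<open>(\<Sum>\<^sub>l e\<^sub>l)\<^sup>2 \<le> (L + 1) \<Sum>\<^sub>l e\<^sub>l\<^sup>2\<close> by Cauchy--Schwarz; this factor \<open>L + 1\<close> is the source
  of the extra \<open>\<bar>log \<epsilon>\<bar>\<close>. The growth condition on \<open>R\<close> makes every error bound a power of \<open>M\<^sub>l\<close>, and
  the optimal choice \<open>N\<^sub>l \<sim> (L + 1) \<epsilon>\<^sup>-\<^sup>2 S M\<^sub>l powr (-(\<beta> + \<gamma>)/2)\<close>, where
  \<open>S = \<Sum>\<^sub>l M\<^sub>l powr ((\<gamma> - \<beta>)/2)\<close>, costs about \<open>(L + 1) \<epsilon>\<^sup>-\<^sup>2 S\<^sup>2\<close>. Rounding \<open>N\<^sub>l\<close> up adds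
  \<open>\<Sum>\<^sub>l M\<^sub>l powr \<gamma> \<sim> \<epsilon> powr (-\<gamma>/\<alpha>)\<close>, which the assumption \<open>\<alpha> \<ge> min \<beta> \<gamma> / 2\<close> absorbs.
\<close>

section \<open>Geometric sums over the levels and the choice of the finest level\<close>

text \<open>With a positive exponent the finest level dominates, up to a factor independent of
  \<open>L\<close>. This serves the work sum when \<beta> < \<gamma> and the cost of rounding in
  every case.\<close>

lemma sum_powr_geometric_increasing:
  fixes m s \<delta> :: real
  assumes "m > 0" "s > 1" "\<delta> > 0"
  shows "(\<Sum>l\<le>L. (m * s ^ l) powr \<delta>) \<le> s powr \<delta> / (s powr \<delta> - 1) * (m * s ^ L) powr \<delta>"
proof -
  define q where "q = s powr \<delta>"
  have q: "q > 1" using assms by (simp add: q_def)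
  have x: "(m * s ^ l) powr \<delta> = m powr \<delta> * q ^ l" for l
    using assms by (simp add: q_def powr_mult powr_powr powr_realpow [symmetric] mult.commute)
  have "(\<Sum>l\<le>L. q ^ l) = (q ^ Suc L - 1) / (q - 1)"
    using geometric_sum[of q "Suc L"] q by (simp add: lessThan_Suc_atMost)
  also have "\<dots> \<le> q / (q - 1) * q ^ L"
    using q by (simp add: divide_right_mono)
  finally have "m powr \<delta> * (\<Sum>l\<le>L. q ^ l) \<le> m powr \<delta> * (q / (q - 1) * q ^ L)"
    by (intro mult_left_mono) auto
  then show ?thesis
    by (simp only: x sum_distrib_left [symmetric] q_def [symmetric]) (simp add: algebra_simps)
qed

text \<open>With a negative exponent the coarsest level dominates, so the bound is uniform in
  \<open>L\<close>; this is the case \<beta> > \<gamma>.\<close>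

lemma sum_powr_geometric_decreasing:
  fixes m s \<delta> :: real
  assumes "m > 0" "s > 1" "\<delta> < 0"
  shows "(\<Sum>l\<le>L. (m * s ^ l) powr \<delta>) \<le> m powr \<delta> / (1 - s powr \<delta>)"
proof -
  define q where "q = s powr \<delta>"
  have q: "0 < q" "q < 1" using assms powr_less_mono[of \<delta> 0 s] by (simp_all add: q_def)
  have x: "(m * s ^ l) powr \<delta> = m powr \<delta> * q ^ l" for l
    using assms by (simp add: q_def powr_mult powr_powr powr_realpow [symmetric] mult.commute)
  have "(\<Sum>l\<le>L. q ^ l) = (1 - q ^ Suc L) / (1 - q)"
    using sum_gp0[of q L] q by simp
  also have "\<dots> \<le> 1 / (1 - q)"
    using q by (intro divide_right_mono) auto
  finally have "m powr \<delta> * (\<Sum>l\<le>L. q ^ l) \<le> m powr \<delta> * (1 / (1 - q))"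
    by (intro mult_left_mono) auto
  then show ?thesis
    by (simp only: x sum_distrib_left [symmetric] q_def [symmetric]) simp
qed

text \<open>The least level reaching the threshold overshoots it by at most a factor
  \<open>s\<close>, because the level below still misses it. The summand \<open>m\<close> covers the
  case in which level 0 already suffices.\<close>

lemma geometric_level_exists:
  fixes m s T :: real
  assumes "m > 0" "s > 1" "T > 0"
  obtains L :: nat where "T \<le> m * s ^ L" "m * s ^ L \<le> s * (m + T)"
proof -
  obtain k where "T / m < s ^ k" using real_arch_pow[OF \<open>s > 1\<close>] by blast
  then have ex: "T \<le> m * s ^ k" using assms by (simp add: field_simps)
  define L where "L = (LEAST l. T \<le> m * s ^ l)"
  have L: "T \<le> m * s ^ L" unfolding L_def using ex by (rule LeastI)
  have "m * s ^ L \<le> s * (m + T)"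
  proof (cases L)
    case 0
    have "1 * m \<le> s * (m + T)" using assms by (intro mult_mono) auto
    then show ?thesis using 0 by simp
  next
    case (Suc k)
    then have "\<not> T \<le> m * s ^ k" unfolding L_def by (intro not_less_Least) simp
    then have "s * (m * s ^ k) \<le> s * (m + T)" using assms by (intro mult_left_mono) auto
    then show ?thesis using Suc by (simp add: mult_ac)
  qed
  with L show ?thesis using that by blast
qed

section \<open>Comparison of the work with the claimed rate\<close>

text \<open>The left side is the order of the cost of one sample on every level. If \<beta> <
  \<gamma>, the condition on \<alpha> reads \<beta> \<le> 2\<alpha>, that is \<gamma>/\<alpha> \<le>
  2 + (\<gamma> - \<beta>)/\<alpha>; otherwise it reads \<gamma> \<le> 2\<alpha>. The logarithmic
  factors are at least 1 because \<epsilon> < exp (-1).\<close>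

lemma powr_le_ml_rate:
  assumes "\<alpha> > 0" "\<alpha> \<ge> 1 / 2 * min \<beta> \<gamma>" "0 < \<epsilon>" "\<epsilon> < exp (-1)"
  shows "\<epsilon> powr (- \<gamma> / \<alpha>) \<le> ml_rate \<alpha> \<beta> \<gamma> \<epsilon>"
proof -
  have e1: "\<epsilon> < 1" using assms(4) by (rule less_trans) simp
  have "ln \<epsilon> < -1" using assms(3,4) by (metis ln_exp ln_less_cancel_iff exp_gt_zero)
  then have l1: "\<bar>ln \<epsilon>\<bar> \<ge> 1" by simp
  show ?thesis
  proof (cases "\<beta> < \<gamma>")
    case True
    have "\<epsilon> powr (- \<gamma> / \<alpha>) \<le> \<epsilon> powr (-2 - (\<gamma> - \<beta>) / \<alpha>)"
      using assms e1 True by (intro powr_mono') (auto simp: field_simps)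
    also have "\<dots> \<le> \<epsilon> powr (-2 - (\<gamma> - \<beta>) / \<alpha>) * \<bar>ln \<epsilon>\<bar>"
      using l1 by (simp add: mult_le_cancel_left1)
    finally show ?thesis using True by (simp add: ml_rate_def)
  next
    case False
    have a: "\<epsilon> powr (- \<gamma> / \<alpha>) \<le> \<epsilon> powr (-2)"
      using assms e1 False by (intro powr_mono') (auto simp: field_simps)
    have "1 \<le> \<bar>ln \<epsilon>\<bar> ^ 3" using l1 by (rule one_le_power)
    then have "\<epsilon> powr (-2) \<le> \<epsilon> powr (-2) * \<bar>ln \<epsilon>\<bar> ^ 3" "\<epsilon> powr (-2) \<le> \<epsilon> powr (-2) * \<bar>ln \<epsilon>\<bar>"
      using l1 mult_left_mono[of 1 _ "\<epsilon> powr (-2)"] by fastforce+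
    with a show ?thesis using False by (auto simp: ml_rate_def)
  qed
qed

text \<open>The three regimes of the rate are the three signs of the exponent (\<gamma> -
  \<beta>)/2: the work sum is bounded, equal to the number of levels, or dominated by its last term.
  The constant is fixed before \<open>L\<close> and \<epsilon>.\<close>

lemma squared_work_sum_le_ml_rate:
  fixes m s \<alpha> \<beta> \<gamma> X H :: real
  assumes "m > 0" "s > 1" "\<alpha> > 0" "X > 0" "H > 0"
  obtains K where "K > 0"
    "\<And>L \<epsilon>. 0 < \<epsilon> \<Longrightarrow> m * s ^ L \<le> X * \<epsilon> powr (- 1 / \<alpha>) \<Longrightarrow> real L + 1 \<le> H * \<bar>ln \<epsilon>\<bar> \<Longrightarrow>
       (real L + 1) * \<epsilon> powr (-2) * (\<Sum>l\<le>L. (m * s ^ l) powr ((\<gamma> - \<beta>) / 2))\<^sup>2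
         \<le> K * ml_rate \<alpha> \<beta> \<gamma> \<epsilon>"
proof -
  define S where "S L = (\<Sum>l\<le>L. (m * s ^ l) powr ((\<gamma> - \<beta>) / 2))" for L
  have S0: "S L \<ge> 0" for L by (simp add: S_def sum_nonneg)
  consider "\<beta> > \<gamma>" | "\<beta> = \<gamma>" | "\<beta> < \<gamma>" by linarith
  then show ?thesis
  proof cases
    case 1
    define c where "c = m powr ((\<gamma> - \<beta>) / 2) / (1 - s powr ((\<gamma> - \<beta>) / 2))"
    have c0: "c > 0"
      using 1 assms powr_less_mono[of "(\<gamma> - \<beta>) / 2" 0 s] by (simp add: c_def)
    have "S L \<le> c" for L
      unfolding S_def c_def using 1 assms by (intro sum_powr_geometric_decreasing) auto
    then have S2: "(S L)\<^sup>2 \<le> c\<^sup>2" for L using S0 by (intro power_mono) auto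
    have "(real L + 1) * \<epsilon> powr (-2) * (S L)\<^sup>2 \<le> (H * c\<^sup>2) * ml_rate \<alpha> \<beta> \<gamma> \<epsilon>"
      if "real L + 1 \<le> H * \<bar>ln \<epsilon>\<bar>" for L \<epsilon>
    proof -
      have "(real L + 1) * \<epsilon> powr (-2) * (S L)\<^sup>2 \<le> (H * \<bar>ln \<epsilon>\<bar>) * \<epsilon> powr (-2) * c\<^sup>2"
        using that S2 by (intro mult_mono) auto
      then show ?thesis using 1 by (simp add: ml_rate_def mult_ac)
    qed
    then show ?thesis using that[of "H * c\<^sup>2"] c0 assms by (auto simp: S_def)
  next
    case 2
    \<comment> \<open>Every term is a zeroth power. The square thus adds two factors
      \<open>L + 1\<close> to the one already present, whence the cube of the logarithm.\<close>
    have S: "S L = real L + 1" for L using 2 assms by (simp add: S_def)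
    have "(real L + 1) * \<epsilon> powr (-2) * (S L)\<^sup>2 \<le> H ^ 3 * ml_rate \<alpha> \<beta> \<gamma> \<epsilon>"
      if "real L + 1 \<le> H * \<bar>ln \<epsilon>\<bar>" for L \<epsilon>
    proof -
      have "(real L + 1) ^ 3 \<le> (H * \<bar>ln \<epsilon>\<bar>) ^ 3" using that by (intro power_mono) auto
      then have "\<epsilon> powr (-2) * (real L + 1) ^ 3 \<le> \<epsilon> powr (-2) * (H * \<bar>ln \<epsilon>\<bar>) ^ 3"
        by (intro mult_left_mono) auto
      then show ?thesis
        using 2 unfolding S by (simp add: ml_rate_def power2_eq_square power3_eq_cube mult_ac)
    qed
    then show ?thesis using that[of "H ^ 3"] assms by (auto simp: S_def)
  next
    case 3
    define \<delta> where "\<delta> = (\<gamma> - \<beta>) / 2"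
    have d: "\<delta> > 0" using 3 by (simp add: \<delta>_def)
    define c where "c = s powr \<delta> / (s powr \<delta> - 1)"
    have c0: "c > 0" using d assms by (simp add: c_def)
    have S1: "S L \<le> c * (m * s ^ L) powr \<delta>" for L
      unfolding S_def c_def \<delta>_def[symmetric] using d assms
      by (intro sum_powr_geometric_increasing) auto
    have "(real L + 1) * \<epsilon> powr (-2) * (S L)\<^sup>2
        \<le> (H * (c * X powr \<delta>)\<^sup>2) * ml_rate \<alpha> \<beta> \<gamma> \<epsilon>"
      if e: "0 < \<epsilon>" and x: "m * s ^ L \<le> X * \<epsilon> powr (- 1 / \<alpha>)"
        and L: "real L + 1 \<le> H * \<bar>ln \<epsilon>\<bar>" for L \<epsilon>
    proof -
      \<comment> \<open>The bound on the finest level turns the dominating term into a power of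
        \<epsilon>; as \<delta> is half of \<gamma> - \<beta>, squaring produces the extra exponent
        -(\<gamma> - \<beta>)/\<alpha> of the rate.\<close>
      have "(m * s ^ L) powr \<delta> \<le> (X * \<epsilon> powr (- 1 / \<alpha>)) powr \<delta>"
        using x d assms by (intro powr_mono2) auto
      also have "\<dots> = X powr \<delta> * \<epsilon> powr (- \<delta> / \<alpha>)"
        using assms by (simp add: powr_mult powr_powr)
      finally have "S L \<le> c * (X powr \<delta> * \<epsilon> powr (- \<delta> / \<alpha>))"
        using c0 by (intro order_trans[OF S1] mult_left_mono) auto
      then have "(S L)\<^sup>2 \<le> (c * (X powr \<delta> * \<epsilon> powr (- \<delta> / \<alpha>)))\<^sup>2"
        using S0 by (intro power_mono) auto
      also have "\<dots> = (c * X powr \<delta>)\<^sup>2 * (\<epsilon> powr (- \<delta> / \<alpha>) * \<epsilon> powr (- \<delta> / \<alpha>))"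
        by (simp add: power2_eq_square mult_ac)
      also have "\<epsilon> powr (- \<delta> / \<alpha>) * \<epsilon> powr (- \<delta> / \<alpha>) = \<epsilon> powr (- ((\<gamma> - \<beta>) / \<alpha>))"
        by (simp add: powr_add [symmetric] \<delta>_def field_simps minus_divide_left)
      finally have "(real L + 1) * \<epsilon> powr (-2) * (S L)\<^sup>2
          \<le> (H * \<bar>ln \<epsilon>\<bar>) * \<epsilon> powr (-2) * ((c * X powr \<delta>)\<^sup>2 * \<epsilon> powr (- ((\<gamma> - \<beta>) / \<alpha>)))"
        using L by (intro mult_mono) auto
      also have "\<dots> = H * (c * X powr \<delta>)\<^sup>2
          * ((\<epsilon> powr (-2) * \<epsilon> powr (- ((\<gamma> - \<beta>) / \<alpha>))) * \<bar>ln \<epsilon>\<bar>)"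
        by (simp only: mult_ac)
      also have "\<epsilon> powr (-2) * \<epsilon> powr (- ((\<gamma> - \<beta>) / \<alpha>)) = \<epsilon> powr (-2 - (\<gamma> - \<beta>) / \<alpha>)"
        by (simp add: powr_add [symmetric])
      finally show ?thesis using 3 by (simp add: ml_rate_def)
    qed
    then show ?thesis using that[of "H * (c * X powr \<delta>)\<^sup>2"] c0 assms by (auto simp: S_def)
  qed
qed

section \<open>Deterministic choice of the number of levels and of the sample sizes\<close>

text \<open>\<open>B\<close> and \<open>A\<close> stand for the constants of the bias and of the
  mean square error per level. The tolerances \<epsilon>/2 and \<epsilon>^2/8 anticipate that both
  contributions get doubled: 2 (\<epsilon>/2)^2 + 2 (\<epsilon>^2/8) is still below
  \<epsilon>^2.\<close>

lemma multilevel_parameters_exist: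
  fixes m s \<alpha> \<beta> \<gamma> A B :: real
  assumes "m \<ge> 1" "s > 1" "\<alpha> > 0" "\<gamma> > 0" "\<alpha> \<ge> 1 / 2 * min \<beta> \<gamma>" "A > 0" "B > 0"
  obtains K where "K > 0"
    "\<And>\<epsilon>. 0 < \<epsilon> \<Longrightarrow> \<epsilon> < exp (-1) \<Longrightarrow> \<exists>L N. (\<forall>l. N l \<ge> (1::nat))
       \<and> B * (m * s ^ L) powr (- \<alpha>) \<le> \<epsilon> / 2
       \<and> (real L + 1) * (\<Sum>l\<le>L. A * (m * s ^ l) powr (- \<beta>) / real (N l)) \<le> \<epsilon>\<^sup>2 / 8
       \<and> (\<Sum>l\<le>L. real (N l) * (m * s ^ l) powr \<gamma>) \<le> K * ml_rate \<alpha> \<beta> \<gamma> \<epsilon>"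
proof -
  \<comment> \<open>The level chosen below has size at most \<open>s * (m + T)\<close>, where
    \<open>T\<close> is a multiple of \<open>\<epsilon> powr (- 1 / \<alpha>)\<close>. That power is
    at least 1, so it can be factored out of \<open>m\<close> as well, leaving
    \<open>X\<close>.\<close>
  define X where "X = s * (m + (2 * B) powr (1 / \<alpha>))"
  have X: "X > 0" using assms by (simp add: X_def add_pos_nonneg)
  \<comment> \<open>Logarithms of \<open>s ^ L \<le> X * \<epsilon> powr (- 1 / \<alpha>)\<close>
    bound \<open>L\<close>; the summand 1 pays for the \<open>+ 1\<close> in the number of levels,
    and constants are absorbed since \<open>\<bar>ln \<epsilon>\<bar>\<close> exceeds 1.\<close>
  define H where "H = 1 + (\<bar>ln X\<bar> + 1 / \<alpha>) / ln s"
  have H: "H > 0" using assms by (simp add: H_def add_pos_nonneg)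
  have m0: "m > 0" using assms by simp
  obtain K1 where K1: "K1 > 0"
    "\<And>L \<epsilon>. 0 < \<epsilon> \<Longrightarrow> m * s ^ L \<le> X * \<epsilon> powr (- 1 / \<alpha>) \<Longrightarrow> real L + 1 \<le> H * \<bar>ln \<epsilon>\<bar> \<Longrightarrow>
       (real L + 1) * \<epsilon> powr (-2) * (\<Sum>l\<le>L. (m * s ^ l) powr ((\<gamma> - \<beta>) / 2))\<^sup>2
         \<le> K1 * ml_rate \<alpha> \<beta> \<gamma> \<epsilon>"
    using squared_work_sum_le_ml_rate[OF m0 \<open>s > 1\<close> \<open>\<alpha> > 0\<close> X H, of \<gamma> \<beta>] by blast
  define c where "c = s powr \<gamma> / (s powr \<gamma> - 1)"
  have c0: "c > 0" using assms by (simp add: c_def)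
  \<comment> \<open>The first summand comes from the unrounded sample sizes, the second from
    rounding them up.\<close>
  define K where "K = 8 * A * K1 + c * X powr \<gamma>"
  have K0: "K > 0" using assms K1 c0 by (simp add: K_def add_pos_nonneg)
  moreover have "\<exists>L N. (\<forall>l. N l \<ge> (1::nat))
       \<and> B * (m * s ^ L) powr (- \<alpha>) \<le> \<epsilon> / 2
       \<and> (real L + 1) * (\<Sum>l\<le>L. A * (m * s ^ l) powr (- \<beta>) / real (N l)) \<le> \<epsilon>\<^sup>2 / 8
       \<and> (\<Sum>l\<le>L. real (N l) * (m * s ^ l) powr \<gamma>) \<le> K * ml_rate \<alpha> \<beta> \<gamma> \<epsilon>"
    if e: "0 < \<epsilon>" "\<epsilon> < exp (-1)" for \<epsilon>
  proof -
    have e1: "\<epsilon> < 1" using e(2) by (rule less_trans) simp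
    have ln: "ln \<epsilon> < -1" using e by (metis ln_exp ln_less_cancel_iff exp_gt_zero)
    \<comment> \<open>The size at which the bias bound equals its tolerance:
      \<open>B * T powr (- \<alpha>) = \<epsilon> / 2\<close>.\<close>
    define T where "T = (2 * B / \<epsilon>) powr (1 / \<alpha>)"
    have T0: "T > 0" using assms e by (simp add: T_def)
    obtain L where L: "T \<le> m * s ^ L" "m * s ^ L \<le> s * (m + T)"
      using geometric_level_exists[OF m0 \<open>s > 1\<close> T0] by blast
    define x where "x l = m * s ^ l" for l
    have x0: "x l > 0" for l using m0 assms by (simp add: x_def)
    have T: "T = (2 * B) powr (1 / \<alpha>) * \<epsilon> powr (- 1 / \<alpha>)"
      using assms e by (simp add: T_def powr_divide powr_minus field_simps)
    have "1 \<le> \<epsilon> powr (- 1 / \<alpha>)"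
      using e e1 assms powr_mono'[of "- 1 / \<alpha>" 0 \<epsilon>] by simp
    then have "m + T \<le> (m + (2 * B) powr (1 / \<alpha>)) * \<epsilon> powr (- 1 / \<alpha>)"
      using m0 mult_left_mono[of 1 "\<epsilon> powr (- 1 / \<alpha>)" m] by (simp add: T distrib_right)
    then have "s * (m + T) \<le> X * \<epsilon> powr (- 1 / \<alpha>)"
      using assms by (simp add: X_def mult.assoc)
    with L have xL: "x L \<le> X * \<epsilon> powr (- 1 / \<alpha>)" by (simp add: x_def)
    have bias: "B * x L powr (- \<alpha>) \<le> \<epsilon> / 2"
    proof -
      have "x L powr (- \<alpha>) \<le> T powr (- \<alpha>)"
        using L T0 assms by (intro powr_mono2') (auto simp: x_def)
      also have "\<dots> = \<epsilon> / (2 * B)"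
        using assms e by (simp add: T_def powr_powr powr_minus field_simps)
      finally have "B * x L powr (- \<alpha>) \<le> B * (\<epsilon> / (2 * B))" using assms by (intro mult_left_mono) auto
      then show ?thesis using assms by simp
    qed
    have Lb: "real L + 1 \<le> H * \<bar>ln \<epsilon>\<bar>"
    proof -
      have "1 * s ^ L \<le> x L" unfolding x_def using assms by (intro mult_right_mono) auto
      then have "s ^ L \<le> X * \<epsilon> powr (- 1 / \<alpha>)" using xL by simp
      then have "ln (s ^ L) \<le> ln (X * \<epsilon> powr (- 1 / \<alpha>))" using assms X e by (intro ln_mono) auto
      then have "real L * ln s \<le> ln X + (1 / \<alpha>) * \<bar>ln \<epsilon>\<bar>"
        using assms X e ln by (simp add: ln_mult ln_realpow)
      also have "ln X \<le> \<bar>ln X\<bar> * \<bar>ln \<epsilon>\<bar>"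
        using ln mult_left_mono[of 1 "\<bar>ln \<epsilon>\<bar>" "\<bar>ln X\<bar>"] by simp
      finally have "real L * ln s \<le> (\<bar>ln X\<bar> + 1 / \<alpha>) * \<bar>ln \<epsilon>\<bar>" by (simp add: distrib_right)
      then have "real L \<le> (\<bar>ln X\<bar> + 1 / \<alpha>) / ln s * \<bar>ln \<epsilon>\<bar>" using assms by (simp add: field_simps)
      moreover have "1 \<le> \<bar>ln \<epsilon>\<bar>" using ln by simp
      ultimately show ?thesis by (simp add: H_def distrib_right)
    qed
    define S where "S = (\<Sum>l\<le>L. x l powr ((\<gamma> - \<beta>) / 2))"
    have S0: "S > 0" unfolding S_def using x0 by (intro sum_pos) (auto simp: less_imp_neq[symmetric])
    \<comment> \<open>Minimising the cost at fixed variance makes the sample sizes proportional to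
      the square root of variance over cost, here
      \<open>x l powr (- (\<beta> + \<gamma>) / 2)\<close>. The factor \<open>D\<close> solves
      \<open>(real L + 1) * (A * S / D) = \<epsilon>\<^sup>2 / 8\<close>.\<close>
    define D where "D = 8 * A * (real L + 1) * \<epsilon> powr (-2) * S"
    have D0: "D > 0" using assms S0 e by (simp add: D_def)
    define k where "k l = D * x l powr (- (\<beta> + \<gamma>) / 2)" for l
    have k0: "k l > 0" for l using D0 x0[of l] by (simp add: k_def)
    \<comment> \<open>Rounding up can only lower the variance, gives at least one sample because
      \<open>k l\<close> is positive, and adds at most one sample per level.\<close>
    define N where "N l = nat \<lceil>k l\<rceil>" for l
    have N: "N l \<ge> 1" "real (N l) \<ge> k l" "real (N l) \<le> k l + 1" for l
      using k0[of l] unfolding N_def by linarith+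
    have "(\<Sum>l\<le>L. A * x l powr (- \<beta>) / real (N l)) \<le> (\<Sum>l\<le>L. A / D * x l powr ((\<gamma> - \<beta>) / 2))"
    proof (rule sum_mono)
      fix l
      have "A * x l powr (- \<beta>) / real (N l) \<le> A * x l powr (- \<beta>) / k l"
        using N k0 assms by (intro divide_left_mono) (auto intro!: mult_pos_pos simp: Suc_le_eq)
      also have "\<dots> = A / D * (x l powr (- \<beta>) / x l powr (- (\<beta> + \<gamma>) / 2))"
        by (simp add: k_def)
      also have "x l powr (- \<beta>) / x l powr (- (\<beta> + \<gamma>) / 2) = x l powr ((\<gamma> - \<beta>) / 2)"
        by (simp add: powr_diff [symmetric] field_simps)
      finally show "A * x l powr (- \<beta>) / real (N l) \<le> A / D * x l powr ((\<gamma> - \<beta>) / 2)" .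
    qed
    also have "\<dots> = A * S / D" by (simp add: S_def sum_distrib_left sum_divide_distrib)
    finally have "(real L + 1) * (\<Sum>l\<le>L. A * x l powr (- \<beta>) / real (N l)) \<le> (real L + 1) * (A * S / D)"
      by (intro mult_left_mono) auto
    also have "\<dots> = \<epsilon>\<^sup>2 / 8"
    proof -
      have "n * (A * S / (8 * A * n * inverse (\<epsilon>\<^sup>2) * S)) = \<epsilon>\<^sup>2 / 8" if "n > 0" for n
        using that assms S0 e by (simp add: field_simps)
      from this[of "real L + 1"] show ?thesis
        using e by (simp add: D_def powr_minus)
    qed
    finally have var: "(real L + 1) * (\<Sum>l\<le>L. A * x l powr (- \<beta>) / real (N l)) \<le> \<epsilon>\<^sup>2 / 8" .
    \<comment> \<open>The exponent (\<gamma> - \<beta>)/2 of the variance sum reappears here, so the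
      main part of the cost is \<open>D * S\<close>, quadratic in \<open>S\<close>.\<close>
    have "(\<Sum>l\<le>L. real (N l) * x l powr \<gamma>) \<le> (\<Sum>l\<le>L. D * x l powr ((\<gamma> - \<beta>) / 2) + x l powr \<gamma>)"
    proof (rule sum_mono)
      fix l
      have "real (N l) * x l powr \<gamma> \<le> (k l + 1) * x l powr \<gamma>"
        using N by (intro mult_right_mono) auto
      also have "\<dots> = D * (x l powr (- (\<beta> + \<gamma>) / 2) * x l powr \<gamma>) + x l powr \<gamma>"
        by (simp add: k_def distrib_right)
      also have "x l powr (- (\<beta> + \<gamma>) / 2) * x l powr \<gamma> = x l powr ((\<gamma> - \<beta>) / 2)"
        by (simp add: powr_add [symmetric] field_simps)
      finally show "real (N l) * x l powr \<gamma> \<le> D * x l powr ((\<gamma> - \<beta>) / 2) + x l powr \<gamma>" .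
    qed
    also have "\<dots> = D * S + (\<Sum>l\<le>L. x l powr \<gamma>)" by (simp add: S_def sum_distrib_left sum.distrib)
    also have "D * S = 8 * A * ((real L + 1) * \<epsilon> powr (-2) * S\<^sup>2)"
      by (simp add: D_def power2_eq_square)
    also have "\<dots> \<le> 8 * A * (K1 * ml_rate \<alpha> \<beta> \<gamma> \<epsilon>)"
      using K1(2)[OF e(1) xL[unfolded x_def] Lb] assms
      by (intro mult_left_mono) (auto simp: S_def x_def)
    also have "(\<Sum>l\<le>L. x l powr \<gamma>) \<le> c * x L powr \<gamma>"
      unfolding c_def x_def using assms m0 by (intro sum_powr_geometric_increasing) auto
    also have "x L powr \<gamma> \<le> (X * \<epsilon> powr (- 1 / \<alpha>)) powr \<gamma>"
      using xL x0[of L] assms by (intro powr_mono2) auto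
    also have "\<dots> = X powr \<gamma> * \<epsilon> powr (- \<gamma> / \<alpha>)"
      using X by (simp add: powr_mult powr_powr)
    also have "\<epsilon> powr (- \<gamma> / \<alpha>) \<le> ml_rate \<alpha> \<beta> \<gamma> \<epsilon>"
      using assms e by (intro powr_le_ml_rate) auto
    finally have "(\<Sum>l\<le>L. real (N l) * x l powr \<gamma>)
        \<le> 8 * A * (K1 * ml_rate \<alpha> \<beta> \<gamma> \<epsilon>) + c * (X powr \<gamma> * ml_rate \<alpha> \<beta> \<gamma> \<epsilon>)"
      using c0 X by simp
    then have "(\<Sum>l\<le>L. real (N l) * x l powr \<gamma>) \<le> K * ml_rate \<alpha> \<beta> \<gamma> \<epsilon>"
      by (simp add: K_def algebra_simps)
    with N(1) bias var show ?thesis unfolding x_def by blast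
  qed
  ultimately show ?thesis using that by blast
qed

section \<open>Mean square of a sum of dependent errors\<close>

text \<open>Bias-variance decomposition about an arbitrary point. For \<open>m\<close> the
  stationary mean its right side is the left side of (M3), so (M3) bounds a mean square
  error.\<close>

lemma (in prob_space) second_moment_about:
  fixes X :: "'a \<Rightarrow> real"
  assumes "integrable M X" "integrable M (\<lambda>w. (X w)\<^sup>2)"
  shows "integrable M (\<lambda>w. (X w - m)\<^sup>2)"
    and "expectation (\<lambda>w. (X w - m)\<^sup>2) = variance X + (expectation X - m)\<^sup>2"
proof -
  have eq: "(\<lambda>w. (X w - m)\<^sup>2) = (\<lambda>w. (X w)\<^sup>2 - 2 * m * X w + m\<^sup>2)"
    by (auto simp: power2_eq_square algebra_simps)
  show "integrable M (\<lambda>w. (X w - m)\<^sup>2)"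
    unfolding eq using assms by auto
  have "expectation (\<lambda>w. (X w - m)\<^sup>2) = expectation (\<lambda>w. (X w)\<^sup>2) - 2 * m * expectation X + m\<^sup>2"
    unfolding eq using assms by (simp add: prob_space)
  then show "expectation (\<lambda>w. (X w - m)\<^sup>2) = variance X + (expectation X - m)\<^sup>2"
    using variance_eq[OF assms] by (simp add: power2_eq_square algebra_simps)
qed

text \<open>Cauchy--Schwarz over \<open>L + 1\<close> terms, combined with (u + b)^2 \<le> 2 u^2 + 2
  b^2. In the application \<open>b\<close> is the deterministic bias.\<close>

lemma square_sum_shift_le:
  fixes e :: "nat \<Rightarrow> real"
  shows "((\<Sum>l\<le>L. e l) + b)\<^sup>2 \<le> 2 * ((real L + 1) * (\<Sum>l\<le>L. (e l)\<^sup>2)) + 2 * b\<^sup>2"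
proof -
  have "(\<Sum>l\<le>L. e l)\<^sup>2 \<le> (real L + 1) * (\<Sum>l\<le>L. (e l)\<^sup>2)"
    using sum_squared_le_sum_of_squares[of e "{..L}"] by (simp add: mult.commute add.commute)
  moreover have "((\<Sum>l\<le>L. e l) + b)\<^sup>2 \<le> 2 * (\<Sum>l\<le>L. e l)\<^sup>2 + 2 * b\<^sup>2"
    using zero_le_power2[of "(\<Sum>l\<le>L. e l) - b"] by (simp add: power2_eq_square algebra_simps)
  ultimately show ?thesis by linarith
qed

text \<open>The pointwise estimate is integrated; it also dominates the square, which settles
  integrability without looking at mixed products.\<close>

lemma (in prob_space) mean_square_sum_shift_le:
  fixes e :: "nat \<Rightarrow> 'a \<Rightarrow> real"
  assumes meas: "\<And>l. l \<le> L \<Longrightarrow> e l \<in> borel_measurable M"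
    and int: "\<And>l. l \<le> L \<Longrightarrow> integrable M (\<lambda>w. (e l w)\<^sup>2)"
  shows "integrable M (\<lambda>w. ((\<Sum>l\<le>L. e l w) + b)\<^sup>2)"
    and "expectation (\<lambda>w. ((\<Sum>l\<le>L. e l w) + b)\<^sup>2)
           \<le> 2 * ((real L + 1) * (\<Sum>l\<le>L. expectation (\<lambda>w. (e l w)\<^sup>2))) + 2 * b\<^sup>2"
proof -
  let ?g = "\<lambda>w. 2 * ((real L + 1) * (\<Sum>l\<le>L. (e l w)\<^sup>2)) + 2 * b\<^sup>2"
  have sq: "integrable M (\<lambda>w. \<Sum>l\<le>L. (e l w)\<^sup>2)"
    using int by (intro Bochner_Integration.integrable_sum) auto
  then have g: "integrable M ?g" by simp
  show i: "integrable M (\<lambda>w. ((\<Sum>l\<le>L. e l w) + b)\<^sup>2)"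
  proof (rule Bochner_Integration.integrable_bound[OF g])
    show "(\<lambda>w. ((\<Sum>l\<le>L. e l w) + b)\<^sup>2) \<in> borel_measurable M"
      using meas by (intro borel_measurable_power borel_measurable_add borel_measurable_sum) auto
    have "norm (((\<Sum>l\<le>L. e l w) + b)\<^sup>2) \<le> norm (?g w)" for w
      using order_trans[OF square_sum_shift_le[of "\<lambda>l. e l w" L b] abs_ge_self]
      unfolding real_norm_def abs_power2 .
    then show "AE w in M. norm (((\<Sum>l\<le>L. e l w) + b)\<^sup>2) \<le> norm (?g w)" by simp
  qed
  have "expectation (\<lambda>w. ((\<Sum>l\<le>L. e l w) + b)\<^sup>2) \<le> expectation ?g"
    using i g square_sum_shift_le by (intro integral_mono) auto
  also have "\<dots> = 2 * ((real L + 1) * expectation (\<lambda>w. \<Sum>l\<le>L. (e l w)\<^sup>2)) + 2 * b\<^sup>2"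
    using sq by (simp add: prob_space)
  also have "expectation (\<lambda>w. \<Sum>l\<le>L. (e l w)\<^sup>2) = (\<Sum>l\<le>L. expectation (\<lambda>w. (e l w)\<^sup>2))"
    using int by (intro Bochner_Integration.integral_sum) auto
  finally show "expectation (\<lambda>w. ((\<Sum>l\<le>L. e l w) + b)\<^sup>2)
           \<le> 2 * ((real L + 1) * (\<Sum>l\<le>L. expectation (\<lambda>w. (e l w)\<^sup>2))) + 2 * b\<^sup>2" .
qed

section \<open>Reduction of the error bounds to powers of the level size\<close>

text \<open>As \<open>x \<ge> 1\<close>, the growth exponent may be lowered to \<open>p / q\<close>,
  and the power \<open>- q\<close> then yields \<open>- p\<close>. It is applied with (\<alpha>,
  \<alpha>') and (\<beta>, \<beta>'), \<open>t\<close> being the maximum of the two ratios.\<close>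

lemma powr_neg_le_of_growth:
  fixes r x c p q t :: real
  assumes "c > 0" "x \<ge> 1" "q > 0" "p / q \<le> t" "r \<ge> c * x powr t"
  shows "r powr (- q) \<le> c powr (- q) * x powr (- p)"
proof -
  have "c * x powr (p / q) \<le> c * x powr t"
    using assms by (intro mult_left_mono powr_mono) auto
  then have "c * x powr (p / q) \<le> r" using assms(5) by linarith
  then have "r powr (- q) \<le> (c * x powr (p / q)) powr (- q)"
    using assms by (intro powr_mono2') auto
  also have "\<dots> = c powr (- q) * x powr (- p)"
    using assms by (simp add: powr_mult powr_powr)
  finally show ?thesis .
qed

text \<open>Passing from level \<open>l - 1\<close> to level \<open>l\<close> costs a factor
  \<open>s powr \<beta>\<close>. At level 0 both conventional values are 1, so the left side is 2,
  which the summand \<open>2 * M 0 powr \<beta>\<close> accounts for.\<close>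

lemma prev_powr_bound:
  fixes M R :: "nat \<Rightarrow> nat" and \<beta> \<beta>' t cR :: real
  assumes "s \<ge> 2" "M 0 > 0" "\<And>l. M (Suc l) = s * M l" "\<And>l. M l \<ge> 1"
    and "\<beta>' > 0" "cR > 0" "\<beta> / \<beta>' \<le> t" "\<And>l. real (R l) \<ge> cR * real (M l) powr t"
  shows "prev M l powr (- \<beta>) + prev R l powr (- \<beta>')
    \<le> (real s powr \<beta> * (1 + cR powr (- \<beta>')) + 2 * real (M 0) powr \<beta>) * real (M l) powr (- \<beta>)"
proof (cases l)
  case 0
  have "2 = 2 * real (M 0) powr \<beta> * real (M 0) powr (- \<beta>)"
    using assms(2) by (simp add: powr_minus)
  moreover have "0 \<le> real s powr \<beta> * (1 + cR powr (- \<beta>')) * real (M 0) powr (- \<beta>)"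
    by (intro mult_nonneg_nonneg add_nonneg_nonneg) auto
  moreover have "prev M l powr (- \<beta>) + prev R l powr (- \<beta>') = 2" using 0 by (simp add: prev_def)
  ultimately show ?thesis unfolding 0 distrib_right by linarith
next
  case (Suc k)
  have "real (R k) powr (- \<beta>') \<le> cR powr (- \<beta>') * real (M k) powr (- \<beta>)"
    using assms(4)[of k] assms(5-8) by (intro powr_neg_le_of_growth[where t = t]) auto
  then have "prev M l powr (- \<beta>) + prev R l powr (- \<beta>')
      \<le> (1 + cR powr (- \<beta>')) * real (M k) powr (- \<beta>)"
    using Suc by (simp add: prev_def distrib_right)
  also have "real (M k) powr (- \<beta>) = real s powr \<beta> * real (M l) powr (- \<beta>)"
    using assms(1,4) Suc assms(3)[of k] by (simp add: powr_mult powr_minus)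
  also have "(1 + cR powr (- \<beta>')) * (real s powr \<beta> * real (M l) powr (- \<beta>))
      = (real s powr \<beta> * (1 + cR powr (- \<beta>'))) * real (M l) powr (- \<beta>)"
    by (simp only: mult_ac)
  also have "\<dots> \<le> (real s powr \<beta> * (1 + cR powr (- \<beta>')) + 2 * real (M 0) powr \<beta>) * real (M l) powr (- \<beta>)"
    by (intro mult_right_mono) auto
  finally show ?thesis .
qed

section \<open>Stationary means and measurability of the estimators\<close>

text \<open>Linearity and transport along the two projections express the mean through the
  marginals. This makes the means telescope over the levels.\<close>

lemma stat_mean_eq_diff:
  fixes \<nu> :: "nat \<Rightarrow> (nat \<Rightarrow> real) measure"
    and \<nu>J :: "nat \<Rightarrow> ((nat \<Rightarrow> real) \<times> (nat \<Rightarrow> real)) measure"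
  assumes "l \<ge> 1"
    and "sets (\<nu>J l) = sets (euclid (R l) \<Otimes>\<^sub>M euclid (R (l - 1)))"
    and "distr (\<nu>J l) (euclid (R l)) fst = \<nu> l"
    and "distr (\<nu>J l) (euclid (R (l - 1))) snd = \<nu> (l - 1)"
    and "\<And>l. Q l \<in> borel_measurable (euclid (R l))"
    and "\<And>l. integrable (\<nu> l) (Q l)"
  shows "stat_mean \<nu> \<nu>J Q l = integral\<^sup>L (\<nu> l) (Q l) - integral\<^sup>L (\<nu> (l - 1)) (Q (l - 1))"
proof -
  have f: "fst \<in> \<nu>J l \<rightarrow>\<^sub>M euclid (R l)" and g: "snd \<in> \<nu>J l \<rightarrow>\<^sub>M euclid (R (l - 1))"
    using measurable_cong_sets[OF assms(2) refl] measurable_fst measurable_snd by blast+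
  have i1: "integrable (\<nu>J l) (\<lambda>z. Q l (fst z))"
    using assms(6)[of l] unfolding assms(3)[symmetric] by (rule integrable_distr[OF f])
  have i2: "integrable (\<nu>J l) (\<lambda>z. Q (l - 1) (snd z))"
    using assms(6)[of "l - 1"] unfolding assms(4)[symmetric] by (rule integrable_distr[OF g])
  have "stat_mean \<nu> \<nu>J Q l = (\<integral>z. Q l (fst z) - Q (l - 1) (snd z) \<partial>\<nu>J l)"
    using assms(1) by (simp add: stat_mean_def diffY_def case_prod_beta')
  also have "\<dots> = (\<integral>z. Q l (fst z) \<partial>\<nu>J l) - (\<integral>z. Q (l - 1) (snd z) \<partial>\<nu>J l)"
    using i1 i2 by (rule Bochner_Integration.integral_diff)
  also have "(\<integral>z. Q l (fst z) \<partial>\<nu>J l) = integral\<^sup>L (\<nu> l) (Q l)"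
    unfolding assms(3)[symmetric] by (rule integral_distr[OF f assms(5), symmetric])
  also have "(\<integral>z. Q (l - 1) (snd z) \<partial>\<nu>J l) = integral\<^sup>L (\<nu> (l - 1)) (Q (l - 1))"
    unfolding assms(4)[symmetric] by (rule integral_distr[OF g assms(5), symmetric])
  finally show ?thesis .
qed

text \<open>An average of equal terms; for \<open>N = 0\<close> the left side would be 0, since
  division by zero gives 0.\<close>

lemma stat_mean_Yhat_eq:
  "N \<ge> 1 \<Longrightarrow> stat_mean_Yhat \<nu> \<nu>J Q n0 l N = stat_mean \<nu> \<nu>J Q l"
  by (simp add: stat_mean_Yhat_def)

lemma borel_measurable_Yhat:
  assumes "\<And>l. Q l \<in> borel_measurable (euclid (R l))"
    and "\<And>l n. th l n \<in> P \<rightarrow>\<^sub>M euclid (R l)"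
    and "\<And>l n. l \<ge> 1 \<Longrightarrow> Th l n \<in> P \<rightarrow>\<^sub>M euclid (R (l - 1))"
  shows "Yhat Q th Th n0 l N \<in> borel_measurable P"
proof -
  have "(\<lambda>w. diffY Q l (th l n w, Th l n w)) \<in> borel_measurable P" for n
  \<comment> \<open>Measurability of \<open>Th\<close> is available only from level 1 on; at level 0
    \<open>diffY\<close> ignores its second component.\<close>
  proof (cases "l = 0")
    case True
    then show ?thesis
      using measurable_compose[OF assms(2,1), of 0 n] by (simp add: diffY_def)
  next
    case False
    then have "(\<lambda>w. Q l (th l n w) - Q (l - 1) (Th l n w)) \<in> borel_measurable P"
      using measurable_compose[OF assms(2,1), of l n] measurable_compose[OF assms(3,1), of l n]
      by auto
    then show ?thesis using False by (simp add: diffY_def)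
  qed
  then show ?thesis unfolding Yhat_def[abs_def] by measurable
qed

section \<open>Mean square error and cost of the multilevel estimator\<close>

theorem theorem3p4:
  fixes M R :: "nat \<Rightarrow> nat" and s :: nat
    and \<nu> :: "nat \<Rightarrow> (nat \<Rightarrow> real) measure"
    and \<nu>J :: "nat \<Rightarrow> ((nat \<Rightarrow> real) \<times> (nat \<Rightarrow> real)) measure"
    and Q :: "nat \<Rightarrow> (nat \<Rightarrow> real) \<Rightarrow> real"
    and \<rho> :: "'r measure" and Qlim :: "'r \<Rightarrow> real"
    and P :: "'w measure"
    and th Th :: "nat \<Rightarrow> nat \<Rightarrow> 'w \<Rightarrow> nat \<Rightarrow> real"
    and n0 :: "nat \<Rightarrow> nat"
    and Cst :: "nat \<Rightarrow> real"
    and \<alpha> \<alpha>' \<beta> \<beta>' \<gamma> CM1 CM2 CM3 CM4 cR :: real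
  assumes "s \<ge> 2" and "M 0 > 0" and "\<And>l. M (Suc l) = s * M l"
    and "\<And>l. R l > 0" and "mono R"
    and "\<And>l. prob_space (\<nu> l)" and "\<And>l. sets (\<nu> l) = sets (euclid (R l))"
    and "\<And>l. Q l \<in> borel_measurable (euclid (R l))"
    and "prob_space \<rho>" and "integrable \<rho> Qlim"
    \<comment> \<open>the stationary joint distributions and their marginals\<close>
    and "\<And>l. l \<ge> 1 \<Longrightarrow> prob_space (\<nu>J l)"
    and "\<And>l. l \<ge> 1 \<Longrightarrow> sets (\<nu>J l) = sets (euclid (R l) \<Otimes>\<^sub>M euclid (R (l - 1)))"
    and "\<And>l. l \<ge> 1 \<Longrightarrow> distr (\<nu>J l) (euclid (R l)) fst = \<nu> l"
    and "\<And>l. l \<ge> 1 \<Longrightarrow> distr (\<nu>J l) (euclid (R (l - 1))) snd = \<nu> (l - 1)"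
    \<comment> \<open>all processes live on one probability space; no independence is assumed\<close>
    and "prob_space P"
    and "\<And>l n. th l n \<in> P \<rightarrow>\<^sub>M euclid (R l)"
    and "\<And>l n. l \<ge> 1 \<Longrightarrow> Th l n \<in> P \<rightarrow>\<^sub>M euclid (R (l - 1))"
    \<comment> \<open>the expectations and variances in (M1)--(M3) exist as real numbers\<close>
    and "\<And>l. integrable (\<nu> l) (Q l)"
    and "integrable (\<nu> 0) (\<lambda>x. (Q 0 x)\<^sup>2)"
    and "\<And>l. l \<ge> 1 \<Longrightarrow> integrable (\<nu>J l) (\<lambda>z. (diffY Q l z)\<^sup>2)"
    and "\<And>l N. N \<ge> 1 \<Longrightarrow> integrable P (\<lambda>w. (Yhat Q th Th n0 l N w)\<^sup>2)"
    and "\<alpha> > 0" and "\<alpha>' > 0" and "\<beta> > 0" and "\<beta>' > 0" and "\<gamma> > 0"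
    and "\<alpha> \<ge> 1 / 2 * min \<beta> \<gamma>"
    and "CM1 > 0" and "CM2 > 0" and "CM3 > 0" and "CM4 > 0"
    and M1: "\<And>l. \<bar>prob_space.expectation (\<nu> l) (Q l) - prob_space.expectation \<rho> Qlim\<bar>
               \<le> CM1 * (real (M l) powr (- \<alpha>) + real (R l) powr (- \<alpha>'))"
    and M2: "\<And>l. stat_var \<nu> \<nu>J Q l \<le> CM2 * (prev M l powr (- \<beta>) + prev R l powr (- \<beta>'))"
    and M3: "\<And>l N. N \<ge> 1 \<Longrightarrow>
               prob_space.variance P (Yhat Q th Th n0 l N)
               + (prob_space.expectation P (Yhat Q th Th n0 l N)
                  - stat_mean_Yhat \<nu> \<nu>J Q n0 l N)\<^sup>2
               \<le> CM3 * (1 / real N) * stat_var \<nu> \<nu>J Q l"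
    and M4: "\<And>l. Cst l \<le> CM4 * real (M l) powr \<gamma>"
    and "cR > 0" and "\<And>l. real (R l) \<ge> cR * real (M l) powr (max (\<alpha> / \<alpha>') (\<beta> / \<beta>'))"
  shows "\<exists>CML > 0. \<forall>\<epsilon>. 0 < \<epsilon> \<and> \<epsilon> < exp (-1) \<longrightarrow>
           (\<exists>L N. (\<forall>l\<le>L. N l \<ge> 1)
              \<and> integrable P (\<lambda>w. (QML Q th Th n0 L N w - prob_space.expectation \<rho> Qlim)\<^sup>2)
              \<and> prob_space.expectation P
                  (\<lambda>w. (QML Q th Th n0 L N w - prob_space.expectation \<rho> Qlim)\<^sup>2) < \<epsilon>\<^sup>2
              \<and> ml_cost Cst L N \<le> CML * ml_rate \<alpha> \<beta> \<gamma> \<epsilon>)"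
proof -
  note s2 = assms(1) and M0 = assms(2) and MSuc = assms(3)
  interpret P: prob_space P by fact
  define \<mu> where "\<mu> = prob_space.expectation \<rho> Qlim"
  define E where "E l = prob_space.expectation (\<nu> l) (Q l)" for l
  have Mpow: "real (M l) = real (M 0) * real s ^ l" for l
    by (induction l) (simp_all add: MSuc)
  have M1': "M l \<ge> 1" for l
    by (induction l) (use s2 M0 MSuc in \<open>auto simp: Suc_le_eq\<close>)
  have Rb: "real (R l) \<ge> cR * real (M l) powr (max (\<alpha> / \<alpha>') (\<beta> / \<beta>'))" for l by fact
  define B where "B = CM1 * (1 + cR powr (- \<alpha>'))"
  have B0: "B > 0" unfolding B_def using \<open>CM1 > 0\<close> by (intro mult_pos_pos add_pos_nonneg) auto
  have bias: "\<bar>E l - \<mu>\<bar> \<le> B * real (M l) powr (- \<alpha>)" for l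
  proof -
    have "real (R l) powr (- \<alpha>') \<le> cR powr (- \<alpha>') * real (M l) powr (- \<alpha>)"
      using M1'[of l] Rb[of l] \<open>cR > 0\<close> \<open>\<alpha>' > 0\<close> by (intro powr_neg_le_of_growth) auto
    then have "CM1 * (real (M l) powr (- \<alpha>) + real (R l) powr (- \<alpha>'))
        \<le> CM1 * (real (M l) powr (- \<alpha>) + cR powr (- \<alpha>') * real (M l) powr (- \<alpha>))"
      using \<open>CM1 > 0\<close> by (intro mult_left_mono add_left_mono) auto
    also have "\<dots> = B * real (M l) powr (- \<alpha>)" by (simp add: B_def algebra_simps)
    finally show ?thesis using M1[of l] unfolding E_def \<mu>_def by linarith
  qed
  \<comment> \<open>Product of the constants of (M3), (M2) and
    \<open>prev_powr_bound\<close>.\<close>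
  define A where "A = CM3 * (CM2 * (real s powr \<beta> * (1 + cR powr (- \<beta>')) + 2 * real (M 0) powr \<beta>))"
  have A0: "A > 0"
    unfolding A_def using \<open>CM2 > 0\<close> \<open>CM3 > 0\<close> s2 M0
    by (intro mult_pos_pos add_nonneg_pos mult_nonneg_nonneg) auto
  have var: "CM3 * stat_var \<nu> \<nu>J Q l \<le> A * real (M l) powr (- \<beta>)" for l
  proof -
    have "prev M l powr (- \<beta>) + prev R l powr (- \<beta>')
      \<le> (real s powr \<beta> * (1 + cR powr (- \<beta>')) + 2 * real (M 0) powr \<beta>) * real (M l) powr (- \<beta>)"
      by (rule prev_powr_bound[where M = M and R = R and t = "max (\<alpha> / \<alpha>') (\<beta> / \<beta>')", OF s2 M0 MSuc M1' \<open>\<beta>' > 0\<close> \<open>cR > 0\<close> max.cobounded2 Rb])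
    then have "CM2 * (prev M l powr (- \<beta>) + prev R l powr (- \<beta>'))
      \<le> CM2 * ((real s powr \<beta> * (1 + cR powr (- \<beta>')) + 2 * real (M 0) powr \<beta>) * real (M l) powr (- \<beta>))"
      using \<open>CM2 > 0\<close> by (intro mult_left_mono) auto
    then have "CM3 * stat_var \<nu> \<nu>J Q l
      \<le> CM3 * (CM2 * ((real s powr \<beta> * (1 + cR powr (- \<beta>')) + 2 * real (M 0) powr \<beta>) * real (M l) powr (- \<beta>)))"
      using M2[of l] \<open>CM3 > 0\<close> by (intro mult_left_mono) auto
    then show ?thesis by (simp add: A_def mult.assoc)
  qed
  define \<mu>Y where "\<mu>Y l = stat_mean \<nu> \<nu>J Q l" for l
  \<comment> \<open>The coarse marginal at each level is the posterior of the level below, so only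
    the finest mean survives; the convention at level 0 starts the sum at
    \<open>E 0\<close>.\<close>
  have tele: "(\<Sum>l\<le>L. \<mu>Y l) = E L" for L
  proof (induction L)
    case 0
    show ?case by (simp add: \<mu>Y_def E_def stat_mean_def)
  next
    case (Suc L)
    have "\<mu>Y (Suc L) = E (Suc L) - E (Suc L - 1)"
      unfolding \<mu>Y_def E_def by (rule stat_mean_eq_diff[where R = R, OF _ assms(12-14) assms(8,18)]) simp_all
    then show ?case using Suc by simp
  qed
  have Ym: "Yhat Q th Th n0 l N \<in> borel_measurable P" for l N
    by (rule borel_measurable_Yhat) fact+
  have Y2: "integrable P (\<lambda>w. (Yhat Q th Th n0 l N w)\<^sup>2)" if "N \<ge> 1" for l N using assms(21)[OF that] .
  have Y1: "integrable P (Yhat Q th Th n0 l N)" if "N \<ge> 1" for l N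
    using P.square_integrable_imp_integrable[OF Ym Y2[OF that]] .
  have err: "P.expectation (\<lambda>w. (Yhat Q th Th n0 l N w - \<mu>Y l)\<^sup>2) \<le> A * real (M l) powr (- \<beta>) / real N"
    if "N \<ge> 1" for l N
  proof -
    have "P.expectation (\<lambda>w. (Yhat Q th Th n0 l N w - \<mu>Y l)\<^sup>2) \<le> CM3 * stat_var \<nu> \<nu>J Q l / real N"
      unfolding P.second_moment_about(2)[OF Y1[OF that] Y2[OF that], of l "\<mu>Y l"]
      using M3[OF that, of l] stat_mean_Yhat_eq[OF that, of \<nu> \<nu>J Q n0 l] unfolding \<mu>Y_def by simp
    also have "\<dots> \<le> A * real (M l) powr (- \<beta>) / real N"
      using var by (intro divide_right_mono) auto
    finally show ?thesis .
  qed
  have m1: "real (M 0) \<ge> 1" and s1: "real s > 1" using M0 s2 by auto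
  \<comment> \<open>The parameter lemma is used with \<open>m = M 0\<close>, and \<open>Mpow\<close>
    is folded to restore \<open>M l\<close>. Since \<open>K\<close> precedes \<epsilon>, the final
    constant \<open>CM4 * K\<close> is independent of \<epsilon>.\<close>
  obtain K where K: "K > 0"
    "\<And>\<epsilon>. 0 < \<epsilon> \<Longrightarrow> \<epsilon> < exp (-1) \<Longrightarrow> \<exists>L N. (\<forall>l. N l \<ge> (1::nat))
       \<and> B * real (M L) powr (- \<alpha>) \<le> \<epsilon> / 2
       \<and> (real L + 1) * (\<Sum>l\<le>L. A * real (M l) powr (- \<beta>) / real (N l)) \<le> \<epsilon>\<^sup>2 / 8
       \<and> (\<Sum>l\<le>L. real (N l) * real (M l) powr \<gamma>) \<le> K * ml_rate \<alpha> \<beta> \<gamma> \<epsilon>"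
    by (rule multilevel_parameters_exist
        [OF m1 s1 \<open>\<alpha> > 0\<close> \<open>\<gamma> > 0\<close> \<open>\<alpha> \<ge> 1 / 2 * min \<beta> \<gamma>\<close> A0 B0, folded Mpow]) (rule that)
  show ?thesis
  proof (intro exI[of _ "CM4 * K"] conjI allI impI)
    show "CM4 * K > 0" using K \<open>CM4 > 0\<close> by simp
    fix \<epsilon> :: real assume "0 < \<epsilon> \<and> \<epsilon> < exp (-1)"
    then have e: "0 < \<epsilon>" "\<epsilon> < exp (-1)" by auto
    obtain L N where LN: "\<And>l. N l \<ge> (1::nat)" "B * real (M L) powr (- \<alpha>) \<le> \<epsilon> / 2"
      "(real L + 1) * (\<Sum>l\<le>L. A * real (M l) powr (- \<beta>) / real (N l)) \<le> \<epsilon>\<^sup>2 / 8"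
      "(\<Sum>l\<le>L. real (N l) * real (M l) powr \<gamma>) \<le> K * ml_rate \<alpha> \<beta> \<gamma> \<epsilon>"
      using K(2)[OF e] by blast
    let ?e = "\<lambda>l w. Yhat Q th Th n0 l (N l) w - \<mu>Y l"
    have decomp: "QML Q th Th n0 L N w - \<mu> = (\<Sum>l\<le>L. ?e l w) + (E L - \<mu>)" for w
      by (simp add: QML_def sum_subtractf tele)
    have e2: "integrable P (\<lambda>w. (?e l w)\<^sup>2)" for l
      using P.second_moment_about(1)[OF Y1 Y2] LN(1) by blast
    have em: "?e l \<in> borel_measurable P" for l using Ym by (intro borel_measurable_diff) auto
    have int: "integrable P (\<lambda>w. (QML Q th Th n0 L N w - \<mu>)\<^sup>2)"
      unfolding decomp by (rule P.mean_square_sum_shift_le(1)[OF em e2])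
    have "P.expectation (\<lambda>w. (QML Q th Th n0 L N w - \<mu>)\<^sup>2)
        \<le> 2 * ((real L + 1) * (\<Sum>l\<le>L. P.expectation (\<lambda>w. (?e l w)\<^sup>2))) + 2 * (E L - \<mu>)\<^sup>2"
      unfolding decomp by (rule P.mean_square_sum_shift_le(2)[OF em e2])
    also have "(real L + 1) * (\<Sum>l\<le>L. P.expectation (\<lambda>w. (?e l w)\<^sup>2))
        \<le> (real L + 1) * (\<Sum>l\<le>L. A * real (M l) powr (- \<beta>) / real (N l))"
      using err LN(1) by (intro mult_left_mono sum_mono) auto
    also have "\<dots> \<le> \<epsilon>\<^sup>2 / 8" by (rule LN(3))
    also have "(E L - \<mu>)\<^sup>2 \<le> (\<epsilon> / 2)\<^sup>2"
      using bias[of L] LN(2) e by (intro abs_le_square_iff[THEN iffD1]) linarith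
    \<comment> \<open>The two tolerances contribute \<epsilon>^2/4 and \<epsilon>^2/2; the remaining
      quarter makes the final inequality strict.\<close>
    finally have "P.expectation (\<lambda>w. (QML Q th Th n0 L N w - \<mu>)\<^sup>2) \<le> 3 / 4 * \<epsilon>\<^sup>2"
      by (simp add: power_divide)
    also have "\<dots> < \<epsilon>\<^sup>2" using e by simp
    finally have mse: "P.expectation (\<lambda>w. (QML Q th Th n0 L N w - \<mu>)\<^sup>2) < \<epsilon>\<^sup>2" .
    have "ml_cost Cst L N \<le> (\<Sum>l\<le>L. CM4 * (real (N l) * real (M l) powr \<gamma>))"
      unfolding ml_cost_def
    proof (rule sum_mono)
      fix l
      have "real (N l) * Cst l \<le> real (N l) * (CM4 * real (M l) powr \<gamma>)"
        using M4 by (intro mult_left_mono) auto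
      then show "real (N l) * Cst l \<le> CM4 * (real (N l) * real (M l) powr \<gamma>)"
        by (simp add: mult_ac)
    qed
    also have "\<dots> = CM4 * (\<Sum>l\<le>L. real (N l) * real (M l) powr \<gamma>)"
      by (simp add: sum_distrib_left)
    also have "\<dots> \<le> CM4 * (K * ml_rate \<alpha> \<beta> \<gamma> \<epsilon>)"
      using LN(4) \<open>CM4 > 0\<close> by (intro mult_left_mono) auto
    finally have cost: "ml_cost Cst L N \<le> CM4 * K * ml_rate \<alpha> \<beta> \<gamma> \<epsilon>" by (simp add: mult.assoc)
    show "\<exists>L N. (\<forall>l\<le>L. N l \<ge> 1)
              \<and> integrable P (\<lambda>w. (QML Q th Th n0 L N w - prob_space.expectation \<rho> Qlim)\<^sup>2)
              \<and> prob_space.expectation P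
                  (\<lambda>w. (QML Q th Th n0 L N w - prob_space.expectation \<rho> Qlim)\<^sup>2) < \<epsilon>\<^sup>2
              \<and> ml_cost Cst L N \<le> CM4 * K * ml_rate \<alpha> \<beta> \<gamma> \<epsilon>"
      by (intro exI[of _ L] exI[of _ N] conjI allI impI LN(1) cost
          int[unfolded \<mu>_def] mse[unfolded \<mu>_def])
  qed
qed

end
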